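(* Let $\delta\geq 3$ be an integer and let $G$ be a connected graph of order $n\geq 2\delta^{2}$ with minimum degree $\delta$. If $$\rho(G)\geq \rho\bigl(K_{\delta}\vee(K_{n-\delta(\delta-1)-1}\cup(\delta(\delta-2)+1)K_1)\bigr),$$ then $G$ contains a strong parity factor unless $G=K_{\delta}\vee(K_{n-\delta(\delta-1)-1}\cup(\delta(\delta-2)+1)K_1)$.
   Context: All graphs are finite, undirected, without loops or multiple edges. $\rho(G)$ denotes the spectral radius of $G$, i.e. the largest eigenvalue of its adjacency matrix. $K_m$ is the complete graph on $m$ vertices; $G_1\cup G_2$ is the disjoint union, $tG$ is the disjoint union of $t$ copies of $G$, and $G_1\vee G_2$ (join) is obtained from $G_1\cup G_2$ by adding all edges between $V(G_1)$ and $V(G_2)$. A graph $G$ contains a strong parity factor if for every subset $X\subseteq V(G)$ with $|X|$ even, $G$ has a spanning subgraph $F$ with $\delta(F)\geq 1$, $d_F(u)\equiv 1 \pmod 2$ for all $u\in X$, and $d_F(v)\equiv 0\pmod 2$ for all $v\in V(G)\setminus X$. *)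

theory Defs
  imports "Graph_Theory.Graph_Theory" "Jordan_Normal_Form.Spectral_Radius"
begin

text \<open>
  Finite simple graphs are the \<^emph>\<open>pair_graph\<close>s of Graph_Theory: finite, loopless digraphs whose
  set of arcs is a symmetric relation, each undirected edge being the two opposite arcs.  Hence
  the degree of a vertex is its out-degree.
\<close>

definition min_degree :: "'a pair_pre_digraph \<Rightarrow> nat" where
  "min_degree G = Min (out_degree (with_proj G) ` pverts G)"

definition complete_graph :: "nat \<Rightarrow> nat pair_pre_digraph" where
  "complete_graph m = \<lparr> pverts = {..<m}, parcs = {(u, v). u < m \<and> v < m \<and> u \<noteq> v} \<rparr>"

definition disjoint_union ::
    "'a pair_pre_digraph \<Rightarrow> 'b pair_pre_digraph \<Rightarrow> ('a + 'b) pair_pre_digraph" where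
  "disjoint_union G H =
     \<lparr> pverts = pverts G <+> pverts H,
       parcs = map_prod Inl Inl ` parcs G \<union> map_prod Inr Inr ` parcs H \<rparr>"

definition copies :: "nat \<Rightarrow> 'a pair_pre_digraph \<Rightarrow> (nat \<times> 'a) pair_pre_digraph" where
  "copies t G =
     \<lparr> pverts = {..<t} \<times> pverts G,
       parcs = {((i, u), (j, v)). i < t \<and> i = j \<and> (u, v) \<in> parcs G} \<rparr>"

definition graph_join ::
    "'a pair_pre_digraph \<Rightarrow> 'b pair_pre_digraph \<Rightarrow> ('a + 'b) pair_pre_digraph" where
  "graph_join G H =
     \<lparr> pverts = pverts (disjoint_union G H),
       parcs = parcs (disjoint_union G H)
         \<union> (Inl ` pverts G) \<times> (Inr ` pverts H) \<union> (Inr ` pverts H) \<times> (Inl ` pverts G) \<rparr>"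

text \<open>
  Matrices are indexed by natural numbers, so an enumeration of the vertices is chosen; a
  different choice conjugates the adjacency matrix by a permutation matrix and leaves its
  spectrum unchanged.
\<close>

definition vertex_enum :: "'a pair_pre_digraph \<Rightarrow> nat \<Rightarrow> 'a" where
  "vertex_enum G = (SOME f. bij_betw f {..<card (pverts G)} (pverts G))"

definition adjacency_matrix :: "'a pair_pre_digraph \<Rightarrow> real mat" where
  "adjacency_matrix G = mat (card (pverts G)) (card (pverts G))
     (\<lambda>(i, j). if (vertex_enum G i, vertex_enum G j) \<in> parcs G then 1 else 0)"

text \<open>
  The spectrum is taken over the reals; this loses no eigenvalue because the adjacency matrix
  of a graph is real symmetric.
\<close>

definition graph_spectral_radius :: "'a pair_pre_digraph \<Rightarrow> real" where
  "graph_spectral_radius G = Max (spectrum (adjacency_matrix G))"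

definition has_strong_parity_factor :: "'a pair_pre_digraph \<Rightarrow> bool" where
  "has_strong_parity_factor G \<longleftrightarrow>
     (\<forall>X \<subseteq> pverts G. even (card X) \<longrightarrow>
        (\<exists>F. pair_graph F \<and> spanning (with_proj F) (with_proj G) \<and> min_degree F \<ge> 1 \<and>
             (\<forall>u \<in> X. odd (out_degree (with_proj F) u)) \<and>
             (\<forall>v \<in> pverts G - X. even (out_degree (with_proj F) v))))"

definition extremal_graph :: "nat \<Rightarrow> nat \<Rightarrow> (nat + nat + nat \<times> nat) pair_pre_digraph" where
  "extremal_graph n d =
     graph_join (complete_graph d)
       (disjoint_union (complete_graph (n - d * (d - 1) - 1))
         (copies (d * (d - 2) + 1) (complete_graph 1)))"

lemma pair_graphI:
  assumes "finite (pverts G)" "parcs G \<subseteq> pverts G \<times> pverts G" "sym (parcs G)"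
    and "\<And>v. (v, v) \<notin> parcs G"
  shows "pair_graph G"
proof -
  have fin: "finite (parcs G)"
    using assms(1,2) by (meson finite_SigmaI finite_subset)
  have ends: "arcs_ends (with_proj G) = parcs G"
    by (auto simp: arcs_ends_def arc_to_ends_def)
  show ?thesis
    by unfold_locales (use assms fin ends in \<open>auto simp: symmetric_def\<close>)
qed

lemma pair_graphD:
  assumes "pair_graph G"
  shows "finite (pverts G)" "parcs G \<subseteq> pverts G \<times> pverts G" "sym (parcs G)"
    "(v, v) \<notin> parcs G"
proof -
  interpret pair_graph G by fact
  have ends: "arcs_ends (with_proj G) = parcs G"
    by (auto simp: arcs_ends_def arc_to_ends_def)
  show "finite (pverts G)" by simp
  show "parcs G \<subseteq> pverts G \<times> pverts G"
    using arc_fst_in_verts arc_snd_in_verts by force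
  show "sym (parcs G)" using pair_sym_arcs ends by (simp add: symmetric_def)
  show "(v, v) \<notin> parcs G" using pair_no_loops by force
qed

lemma pair_graph_complete_graph: "pair_graph (complete_graph m)"
  by (rule pair_graphI) (auto simp: complete_graph_def sym_def)

lemma pair_graph_disjoint_union:
  assumes "pair_graph G" "pair_graph H"
  shows "pair_graph (disjoint_union G H)"
  using pair_graphD[OF assms(1)] pair_graphD[OF assms(2)]
  by (intro pair_graphI) (auto simp: disjoint_union_def sym_def)

lemma pair_graph_copies:
  assumes "pair_graph G"
  shows "pair_graph (copies t G)"
  using pair_graphD[OF assms]
  by (intro pair_graphI) (auto simp: copies_def sym_def)

lemma pair_graph_graph_join:
  assumes "pair_graph G" "pair_graph H"
  shows "pair_graph (graph_join G H)"
proof (rule pair_graphI)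
  note U = pair_graphD[OF pair_graph_disjoint_union[OF assms]]
  show "finite (pverts (graph_join G H))"
    using U(1) by (simp add: graph_join_def)
  show "parcs (graph_join G H) \<subseteq> pverts (graph_join G H) \<times> pverts (graph_join G H)"
    using U(2) by (auto simp: graph_join_def disjoint_union_def)
  have "sym ((Inl ` pverts G) \<times> (Inr ` pverts H) \<union> (Inr ` pverts H) \<times> (Inl ` pverts G))"
    by (auto simp: sym_def)
  from sym_Un[OF U(3) this] show "sym (parcs (graph_join G H))"
    by (simp add: graph_join_def Un_assoc)
  show "(v, v) \<notin> parcs (graph_join G H)" for v
    using U(4)[of v] by (auto simp: graph_join_def)
qed

lemma pair_graph_extremal_graph: "pair_graph (extremal_graph n d)"
  by (simp add: extremal_graph_def pair_graph_graph_join pair_graph_disjoint_union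
      pair_graph_copies pair_graph_complete_graph)

lemma card_extremal_graph:
  assumes "d \<ge> 3" "n \<ge> 2 * d\<^sup>2"
  shows "card (pverts (extremal_graph n d)) = n"
proof -
  obtain k where k: "d = k + 3" using assms(1) le_Suc_ex[of 3 d] by (auto simp: add.commute)
  show ?thesis
    using assms(2) unfolding k
    by (simp add: extremal_graph_def graph_join_def disjoint_union_def copies_def
        complete_graph_def card_Plus card_cartesian_product power2_eq_square algebra_simps)
qed

end

theory Submission
  imports Defs
begin

text \<open>
  Removing from \<open>G\<close> a subgraph whose degrees are at most \<open>d v - g v\<close> and of the same parity, with
  \<open>g = 1\<close> on \<open>X\<close> and \<open>g = 2\<close> elsewhere, leaves a strong parity factor for \<open>X\<close>.  By a Tutte-Berge
  argument, such a subgraph can only be missing if some vertex set \<open>T\<close> leaves at least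
  \<open>(\<Sum>v\<in>T. d v - 2) + 2\<close> components.  In a connected graph of minimum degree \<open>\<delta>\<close> this forces at
  least \<open>\<delta>\<close> components with more than \<open>\<delta>\<close> vertices, so every degree is at most \<open>n - \<delta>\<^sup>2\<close>, and so is
  the spectral radius.  The extremal graph contains a complete graph on
  \<open>n - \<delta>\<^sup>2 + 2 * \<delta> - 1\<close> vertices, so its spectral radius is at least \<open>n - \<delta>\<^sup>2 + 2 * \<delta> - 2\<close>, which
  is larger.
\<close>

subsection \<open>Maximum matchings and components\<close>

text \<open>For symmetric \<open>E\<close> these are the vertex sets of the connected components of
  the subgraph induced on \<open>W\<close>; the reflexive closure makes an isolated vertex a class
  of its own.\<close>

definition components :: "('b \<times> 'b) set \<Rightarrow> 'b set \<Rightarrow> 'b set set" where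
  "components E W = W // (Restr E W)\<^sup>*"

text \<open>A matching is encoded as an involution whose fixed points are the unmatched vertices.\<close>

definition matching_on :: "('b \<times> 'b) set \<Rightarrow> 'b set \<Rightarrow> ('b \<Rightarrow> 'b) \<Rightarrow> bool" where
  "matching_on E V m \<longleftrightarrow> (\<forall>x\<in>V. m x \<in> V \<and> m (m x) = x \<and> (m x \<noteq> x \<longrightarrow> (x, m x) \<in> E))"

definition unmatched :: "'b set \<Rightarrow> ('b \<Rightarrow> 'b) \<Rightarrow> 'b set" where
  "unmatched V m = {x \<in> V. m x = x}"

definition max_matching :: "('b \<times> 'b) set \<Rightarrow> 'b set \<Rightarrow> ('b \<Rightarrow> 'b) \<Rightarrow> bool" where
  "max_matching E V m \<longleftrightarrow> matching_on E V m \<and>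
     (\<forall>m'. matching_on E V m' \<longrightarrow> card (unmatched V m) \<le> card (unmatched V m'))"

lemma ex_max_matching: "\<exists>m. max_matching E V m"
proof -
  have "matching_on E V (\<lambda>x. x)" by (simp add: matching_on_def)
  then show ?thesis
    unfolding max_matching_def
    by (rule ex_has_least_nat[of "matching_on E V" _ "\<lambda>m. card (unmatched V m)"])
qed

text \<open>The orbits \<open>{x, h x}\<close> have two elements each, and the induction removes one
  at a time. This serves for matched vertices, for loops of a projected matching and for the two
  arcs of an edge.\<close>

lemma even_card_involution:
  assumes "finite A" "\<And>x. x \<in> A \<Longrightarrow> h x \<in> A \<and> h (h x) = x \<and> h x \<noteq> x"
  shows "even (card A)"
  using assms
proof (induction "card A" arbitrary: A rule: less_induct)
  case less
  show ?case
  proof (cases "A = {}")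
    case False
    then obtain x where x: "x \<in> A" by blast
    let ?B = "A - {x, h x}"
    have sub: "{x, h x} \<subseteq> A" "card {x, h x} = 2"
      using x less.prems(2)[OF x] by auto
    have card: "card A = card ?B + 2"
      using card_Diff_subset[of "{x, h x}" A] card_mono[OF less.prems(1) sub(1)] sub by simp
    have "even (card ?B)"
    proof (rule less.hyps)
      show "card ?B < card A" using card by simp
      show "finite ?B" using less.prems(1) by simp
      show "h y \<in> ?B \<and> h (h y) = y \<and> h y \<noteq> y" if y: "y \<in> ?B" for y
      proof -
        have "h y \<noteq> x" using y less.prems(2)[of y] by auto
        moreover have "h y \<noteq> h x" using y x less.prems(2)[of y] less.prems(2)[of x] by auto
        ultimately show ?thesis using y less.prems(2)[of y] by simp
      qed
    qed
    then show ?thesis using card by simp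
  qed simp
qed

text \<open>Matched vertices come in pairs, so the numbers of unmatched vertices of two matchings
  never differ by exactly one.\<close>

lemma parity_unmatched:
  assumes "finite V" "matching_on E V m"
  shows "even (card V) \<longleftrightarrow> even (card (unmatched V m))"
proof -
  have "even (card (V - unmatched V m))"
    using assms by (intro even_card_involution[of _ m]) (auto simp: matching_on_def unmatched_def)
  moreover have "card V = card (V - unmatched V m) + card (unmatched V m)"
    using assms(1) by (metis (no_types, lifting) add.commute card_Diff_subset card_mono
      le_add_diff_inverse rev_finite_subset unmatched_def mem_Collect_eq subsetI)
  ultimately show ?thesis by simp
qed

text \<open>An involution that maps \<open>K\<close> into itself also preserves the complement, so
  the two pieces never interfere.\<close>

lemma matching_on_switch:
  assumes "matching_on E V M" "matching_on E V N" "\<And>x. x \<in> K \<Longrightarrow> M x \<in> K \<and> N x \<in> K" "K \<subseteq> V"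
  shows "matching_on E V (\<lambda>x. if x \<in> K then N x else M x)"
  unfolding matching_on_def
proof
  fix x assume "x \<in> V"
  then show "(if x \<in> K then N x else M x) \<in> V \<and>
      (if (if x \<in> K then N x else M x) \<in> K then N (if x \<in> K then N x else M x)
       else M (if x \<in> K then N x else M x)) = x \<and>
      ((if x \<in> K then N x else M x) \<noteq> x \<longrightarrow> (x, if x \<in> K then N x else M x) \<in> E)"
    using assms(1,2) assms(3)[of x] assms(3)[of "M x"] unfolding matching_on_def by force
qed

lemma card_unmatched_switch:
  assumes "finite V" "K \<subseteq> V"
  shows "card (unmatched V (\<lambda>x. if x \<in> K then N x else M x))
    = card (unmatched K N) + card (unmatched (V - K) M)"
proof -
  have "unmatched V (\<lambda>x. if x \<in> K then N x else M x) = unmatched K N \<union> unmatched (V - K) M"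
    using assms(2) by (auto simp: unmatched_def split: if_splits)
  moreover have "finite (unmatched K N)" "finite (unmatched (V - K) M)"
    using assms by (auto simp: unmatched_def intro: rev_finite_subset)
  ultimately show ?thesis
    by (simp add: card_Un_disjoint unmatched_def disjoint_iff)
qed

lemma card_unmatched_split:
  assumes "finite V" "K \<subseteq> V"
  shows "card (unmatched V M) = card (unmatched K M) + card (unmatched (V - K) M)"
  using card_unmatched_switch[OF assms, of M M] by simp

text \<open>The witness is the alternating path from \<open>w\<close> that starts with an edge of \<open>M\<close> and stops at
  the first vertex at an even distance from \<open>w\<close> that \<open>M\<close> leaves unmatched.\<close>

lemma alternating_path:
  assumes M: "matching_on E V M" and N: "matching_on E V N" and w: "w \<in> V" "N w = w"
  obtains K where "w \<in> K" "K \<subseteq> V" "\<And>x. x \<in> K \<Longrightarrow> M x \<in> K \<and> N x \<in> K"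
    "\<And>x y. x \<in> K \<Longrightarrow> y \<in> K \<Longrightarrow> M x = x \<Longrightarrow> M y = y \<Longrightarrow> x = y"
proof -
  define p where "p i = ((\<lambda>x. N (M x)) ^^ i) w" for i
  have p0: "p 0 = w" and pS: "p (Suc i) = N (M (p i))" for i
    by (simp_all add: p_def)
  have MV: "M x \<in> V" "M (M x) = x" if "x \<in> V" for x using M that by (auto simp: matching_on_def)
  have NV: "N x \<in> V" "N (N x) = x" if "x \<in> V" for x using N that by (auto simp: matching_on_def)
  have pV: "p i \<in> V" for i by (induction i) (simp_all add: p0 pS w MV NV)
  \<comment> \<open>\<open>J\<close> is the initial segment ending at the first index where
    \<open>M\<close> fixes \<open>p j\<close>. If no such index exists, \<open>J\<close> is all of
    the naturals and \<open>K\<close> has no vertex fixed by \<open>M\<close>.\<close>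
  define J where "J = {j. \<forall>l<j. M (p l) \<noteq> p l}"
  define K where "K = p ` J \<union> M ` p ` J"
  have wK: "w \<in> K" unfolding K_def J_def using p0 by (force intro!: UnI1 image_eqI[of _ _ 0])
  have Mfix: "\<exists>j\<in>J. x = p j \<and> M (p j) = p j" if "x \<in> K" "M x = x" for x
    using that unfolding K_def by (auto simp: MV pV)
  have uniq: "i = j" if "i \<in> J" "j \<in> J" "M (p i) = p i" "M (p j) = p j" for i j
    using that linorder_neqE_nat[of i j] unfolding J_def by blast
  \<comment> \<open>\<open>N\<close> leads from \<open>p (Suc i)\<close> back to
    \<open>M (p i)\<close>; at the start of the path it fixes \<open>w\<close>.\<close>
  have Np: "N (p j) \<in> K" if "j \<in> J" for j
  proof (cases j)
    case 0
    then show ?thesis using wK by (simp add: p0 w)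
  next
    case (Suc i)
    then have "i \<in> J" using that by (auto simp: J_def)
    then show ?thesis using Suc by (simp add: K_def pS NV MV pV)
  qed
  have NMp: "N (M (p j)) \<in> K" if "j \<in> J" for j
  proof (cases "M (p j) = p j")
    case True
    then show ?thesis using Np[OF that] by simp
  next
    case False
    then have "Suc j \<in> J" using that by (auto simp: J_def less_Suc_eq)
    then show ?thesis unfolding K_def pS[symmetric] by blast
  qed
  show ?thesis
  proof (rule that[of K])
    show "w \<in> K" by (rule wK)
    show "K \<subseteq> V" by (auto simp: K_def pV MV)
    show "M x \<in> K \<and> N x \<in> K" if "x \<in> K" for x
      using that Np NMp by (auto simp: K_def MV pV)
    show "x = y" if "x \<in> K" "y \<in> K" "M x = x" "M y = y" for x y
      using Mfix[of x] Mfix[of y] uniq that by metis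
  qed
qed

text \<open>Gallai's lemma, by induction along a walk from \<open>u\<close> to \<open>v\<close> with
  last edge from \<open>w\<close> to \<open>v\<close>. Exchanging \<open>m\<close> with a maximum
  matching that misses \<open>w\<close>, along an alternating path from \<open>w\<close>, gives a
  maximum matching that misses \<open>w\<close> and still misses \<open>u\<close> or
  \<open>v\<close>. The matching changes, hence \<open>m\<close> is arbitrary in the
  induction.\<close>

lemma gallai_connected:
  assumes fin: "finite V" and sym: "sym E"
    and miss: "\<And>v. v \<in> V \<Longrightarrow> \<exists>m. max_matching E V m \<and> m v = v"
    and conn: "(u, v) \<in> (Restr E V)\<^sup>*"
    and m: "max_matching E V m" "m u = u" "m v = v"
  shows "u = v"
  using conn m
proof (induction arbitrary: m rule: rtrancl_induct)
  case (step w v)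
  \<comment> \<open>Two adjacent unmatched vertices could be matched to each other, contradicting
    maximality.\<close>
  have adj: "x = y" if mx: "max_matching E V m'" "m' x = x" "m' y = y" and e: "(x, y) \<in> Restr E V"
    for m' x y
  proof (rule ccontr)
    assume ne: "x \<noteq> y"
    let ?m = "m'(x := y, y := x)"
    have mm: "matching_on E V m'" using mx(1) by (simp add: max_matching_def)
    have "matching_on E V ?m"
      unfolding matching_on_def
    proof (intro ballI)
      fix z assume z: "z \<in> V"
      have "m' z \<in> V" "m' (m' z) = z" "m' z \<noteq> z \<longrightarrow> (z, m' z) \<in> E"
        using mm z by (auto simp: matching_on_def)
      then show "?m z \<in> V \<and> ?m (?m z) = z \<and> (?m z \<noteq> z \<longrightarrow> (z, ?m z) \<in> E)"
        using e ne mx symD[OF sym, of x y] by auto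
    qed
    moreover have "unmatched V ?m \<subset> unmatched V m'"
      using mx e ne by (auto simp: unmatched_def split: if_splits)
    then have "card (unmatched V ?m) < card (unmatched V m')"
      using fin by (intro psubset_card_mono) (auto simp: unmatched_def)
    ultimately show False using mx(1) unfolding max_matching_def by (meson leD)
  qed
  note IH = step.IH
  show ?case
  proof (rule ccontr)
    assume uv: "u \<noteq> v"
    have wV: "w \<in> V" "v \<in> V" using step.hyps by auto
    obtain N where N: "max_matching E V N" "N w = w" using miss wV by blast
    have M': "matching_on E V m" and N': "matching_on E V N"
      using step.prems N by (auto simp: max_matching_def)
    obtain K where K: "w \<in> K" "K \<subseteq> V" "\<And>x. x \<in> K \<Longrightarrow> m x \<in> K \<and> N x \<in> K"
      and K1: "\<And>x y. x \<in> K \<Longrightarrow> y \<in> K \<Longrightarrow> m x = x \<Longrightarrow> m y = y \<Longrightarrow> x = y"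
      using alternating_path[OF M' N' wV(1) N(2)] by (metis (no_types, lifting))
    define M2 where "M2 = (\<lambda>x. if x \<in> K then N x else m x)"
    define N2 where "N2 = (\<lambda>x. if x \<in> K then m x else N x)"
    have M2: "matching_on E V M2" unfolding M2_def by (rule matching_on_switch[OF M' N' K(3,2)])
    have N2: "matching_on E V N2" unfolding N2_def
      using matching_on_switch[OF N' M' _ K(2)] K(3) by blast
    \<comment> \<open>\<open>N\<close> and \<open>N2\<close> differ only on \<open>K\<close>, so
      maximality of \<open>N\<close> gives a comparison inside \<open>K\<close>; this says that
      \<open>M2\<close> leaves no more vertices unmatched than \<open>m\<close>.\<close>
    have "card (unmatched V N) \<le> card (unmatched V N2)" using N N2 by (auto simp: max_matching_def)
    then have "card (unmatched K N) \<le> card (unmatched K m)"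
      unfolding N2_def card_unmatched_switch[OF fin K(2)] card_unmatched_split[OF fin K(2), of N] by simp
    then have "card (unmatched V M2) \<le> card (unmatched V m)"
      unfolding M2_def card_unmatched_switch[OF fin K(2)] card_unmatched_split[OF fin K(2), of m] by simp
    then have M2max: "max_matching E V M2"
      using M2 step.prems(1) unfolding max_matching_def by (meson order_trans)
    have M2w: "M2 w = w" using K N by (simp add: M2_def)
    have "\<not> (u \<in> K \<and> v \<in> K)" using K1 step.prems uv by blast
    then consider "u \<notin> K" | "v \<notin> K" by blast
    then show False
    proof cases
      case 1
      then have "M2 u = u" using step.prems by (simp add: M2_def)
      then have "u = w" using IH[OF M2max _ M2w] by blast
      then show False using 1 K(1) by simp
    next
      case 2
      then have "M2 v = v" using step.prems by (simp add: M2_def)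
      then have "w = v" using adj[OF M2max M2w _ step.hyps(2)] by blast
      then show False using 2 K(1) by simp
    qed
  qed
qed simp

text \<open>The inequality of the Berge formula, weakened by counting all components and not only the
  odd ones.\<close>

theorem berge_components:
  assumes "finite V" "sym E" "max_matching E V m"
  shows "\<exists>S\<subseteq>V. card S + card (unmatched V m) \<le> card (components E (V - S))"
  using assms
proof (induction "card V" arbitrary: V m rule: less_induct)
  case less
  note fin = less.prems(1)
  show ?case
  proof (cases "\<forall>v\<in>V. \<exists>m'. max_matching E V m' \<and> m' v = v")
    \<comment> \<open>By Gallai's lemma each component contains at most one unmatched vertex, so the
      empty set is a witness.\<close>
    case True
    let ?R = "(Restr E V)\<^sup>*"
    have "inj_on (\<lambda>v. ?R `` {v}) (unmatched V m)"
    proof (rule inj_onI)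
      fix u v assume uv: "u \<in> unmatched V m" "v \<in> unmatched V m" "?R `` {u} = ?R `` {v}"
      then have "(u, v) \<in> ?R" by blast
      then show "u = v"
        using gallai_connected[OF fin less.prems(2) _ _ less.prems(3)] True uv
        by (auto simp: unmatched_def)
    qed
    then have "card (unmatched V m) = card ((\<lambda>v. ?R `` {v}) ` unmatched V m)"
      by (simp add: card_image)
    also have "\<dots> \<le> card (components E V)"
      using fin unfolding components_def
      by (intro card_mono) (auto simp: unmatched_def quotient_def)
    finally show ?thesis by (intro exI[of _ "{}"]) simp
  next
    case False
    \<comment> \<open>A vertex missed by no maximum matching is put into the witness; removing it
      must raise the number of unmatched vertices.\<close>
    then obtain v where v: "v \<in> V" "\<And>m'. max_matching E V m' \<Longrightarrow> m' v \<noteq> v" by blast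
    let ?W = "V - {v}"
    obtain k where k: "max_matching E ?W k" using ex_max_matching by blast
    have "card ?W < card V" using v fin by (meson card_Diff1_less)
    then obtain S where S: "S \<subseteq> ?W" "card S + card (unmatched ?W k) \<le> card (components E (?W - S))"
      using less.hyps[OF _ _ less.prems(2) k] fin by blast
    let ?k = "k(v := v)"
    have kW: "matching_on E ?W k" using k by (simp add: max_matching_def)
    then have mk: "matching_on E V ?k" by (auto simp: matching_on_def)
    have "unmatched V ?k = insert v (unmatched ?W k)"
      using v by (auto simp: unmatched_def split: if_splits)
    then have card: "card (unmatched V ?k) = Suc (card (unmatched ?W k))"
      using fin by (simp add: unmatched_def)
    have "\<not> max_matching E V ?k" using v(2)[of ?k] by auto
    then have "card (unmatched V m) < card (unmatched V ?k)"
      using mk less.prems(3) unfolding max_matching_def by (meson leD leI order_trans)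
    moreover have "even (card (unmatched V m)) \<longleftrightarrow> even (card (unmatched V ?k))"
      using parity_unmatched[OF fin mk] parity_unmatched[OF fin, of E m] less.prems(3)
      by (simp add: max_matching_def)
    \<comment> \<open>Parity widens the strict inequality to a gap of two: one unit accounts for
      \<open>v\<close> being unmatched in \<open>?k\<close>, the other for adding \<open>v\<close>
      to the witness.\<close>
    ultimately have "card (unmatched V m) + 2 \<le> card (unmatched V ?k)"
      by (metis add_2_eq_Suc' Suc_leI le_neq_implies_less even_Suc)
    then have "card (insert v S) + card (unmatched V m) \<le> card (components E (?W - S))"
      using S card fin by (subst card_insert_disjoint) (auto intro: finite_subset)
    moreover have "?W - S = V - insert v S" by blast
    ultimately show ?thesis using S v by (intro exI[of _ "insert v S"]) auto
  qed
qed

subsection \<open>Subgraphs with prescribed degree parities\<close>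

lemma sym_rtrancl_Restr: "sym E \<Longrightarrow> sym ((Restr E W)\<^sup>*)"
  by (intro sym_rtrancl) (auto simp: sym_def)

lemma finite_components: "finite W \<Longrightarrow> finite (components E W)"
  by (auto simp: components_def quotient_def)

text \<open>Every vertex \<open>v\<close> is replaced by a clique on \<open>f v\<close> copies.  A perfect matching of the result
  projects to a multigraph with degrees \<open>f\<close>; reducing its multiplicities modulo 2 keeps the
  parities and only lowers the degrees.\<close>

definition blow_up :: "('b \<times> 'b) set \<Rightarrow> (('b \<times> nat) \<times> ('b \<times> nat)) set" where
  "blow_up E = {((u, i), (v, j)). (u = v \<and> i \<noteq> j) \<or> (u, v) \<in> E}"

lemma sym_blow_up: "sym E \<Longrightarrow> sym (blow_up E)"
  by (auto simp: blow_up_def sym_def)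

text \<open>A vertex disappears from the projection only when all its copies are deleted. Surviving
  copies of one vertex are mutually adjacent and every vertex outside \<open>T\<close> has one, so
  walks lift and projection is injective on components.\<close>

lemma card_components_blow_up:
  fixes f :: "'b \<Rightarrow> nat"
  assumes fin: "finite V" and sym: "sym E"
    and S: "S \<subseteq> Sigma V (\<lambda>v. {..<f v})"
    and T_def: "T = {v \<in> V. {v} \<times> {..<f v} \<subseteq> S}"
  shows "card (components (blow_up E) (Sigma V (\<lambda>v. {..<f v}) - S)) \<le> card (components E (V - T))"
proof -
  let ?P = "Sigma V (\<lambda>v. {..<f v}) - S"
  let ?B = "(Restr (blow_up E) ?P)\<^sup>*"
  let ?R = "(Restr E (V - T))\<^sup>*"
  have symR: "sym ?R" and symB: "sym ?B"
    using sym_rtrancl_Restr sym sym_blow_up by metis+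
  have PT: "fst x \<in> V - T" if "x \<in> ?P" for x
    using that by (cases x) (auto simp: T_def)
  have proj: "(fst x, fst y) \<in> ?R" if "(x, y) \<in> ?B" for x y
    using that
  proof (induction rule: rtrancl_induct)
    case (step y z)
    then have "fst y \<in> V - T" "fst z \<in> V - T" using PT by blast+
    moreover have "fst y = fst z \<or> (fst y, fst z) \<in> E" using step by (auto simp: blow_up_def)
    ultimately show ?case using step.IH by (auto intro: rtrancl_into_rtrancl)
  qed simp
  have lift: "((u, i), (v, j)) \<in> ?B" if "(u, v) \<in> ?R" "(u, i) \<in> ?P" "(v, j) \<in> ?P" for u v i j
    using that(1,3)
  proof (induction arbitrary: j rule: rtrancl_induct)
    case base
    then show ?case using that(2) by (cases "i = j") (auto simp: blow_up_def)
  next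
    case (step y z)
    then obtain k where k: "(y, k) \<in> ?P" by (auto simp: T_def)
    then have "((y, k), (z, j)) \<in> Restr (blow_up E) ?P" using step by (auto simp: blow_up_def)
    with step.IH[OF k] show ?case by (rule rtrancl_into_rtrancl)
  qed
  have img: "?R `` (fst ` (?B `` {x})) = ?R `` {fst x}" for x
    using proj by (force intro: rtrancl_trans)
  show ?thesis
  proof (rule card_inj_on_le[where f = "\<lambda>K. ?R `` (fst ` K)"])
    show "inj_on (\<lambda>K. ?R `` (fst ` K)) (components (blow_up E) ?P)"
    proof (rule inj_onI)
      fix K L assume K: "K \<in> components (blow_up E) ?P" and L: "L \<in> components (blow_up E) ?P"
        and eq: "?R `` (fst ` K) = ?R `` (fst ` L)"
      obtain x y where x: "x \<in> ?P" "K = ?B `` {x}" and y: "y \<in> ?P" "L = ?B `` {y}"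
        using K L by (auto simp: components_def elim!: quotientE)
      have "(fst x, fst y) \<in> ?R" using eq unfolding x y img by blast
      then have xy: "(x, y) \<in> ?B" using lift[of "fst x" "fst y" "snd x" "snd y"] x y by simp
      then have "(y, x) \<in> ?B" using symB by (rule symD[rotated])
      then show "K = L" unfolding x y using xy by (auto intro: rtrancl_trans)
    qed
    show "(\<lambda>K. ?R `` (fst ` K)) ` components (blow_up E) ?P \<subseteq> components E (V - T)"
    proof
      fix C assume "C \<in> (\<lambda>K. ?R `` (fst ` K)) ` components (blow_up E) ?P"
      then obtain x where x: "x \<in> ?P" "C = ?R `` {fst x}"
        by (auto simp: components_def img elim!: quotientE)
      then have "fst x \<in> V - T" using PT by blast
      then show "C \<in> components E (V - T)" unfolding x components_def by (rule quotientI)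
    qed
    show "finite (components E (V - T))" using fin by (simp add: finite_components)
  qed
qed

text \<open>The Berge inequality leaves at most one copy unmatched, which is the slack
  \<open>+ 1\<close> in the bound. The number of copies is \<open>sum f V\<close>, so parity
  excludes the single copy.\<close>

lemma perfect_matching_blow_up:
  fixes f :: "'b \<Rightarrow> nat"
  assumes fin: "finite V" and sym: "sym E" and ev: "even (sum f V)"
    and bound: "\<And>T. T \<subseteq> V \<Longrightarrow> card (components E (V - T)) \<le> sum f T + 1"
  obtains m where "matching_on (blow_up E) (Sigma V (\<lambda>v. {..<f v})) m"
    "\<And>x. x \<in> Sigma V (\<lambda>v. {..<f v}) \<Longrightarrow> m x \<noteq> x"
proof -
  let ?P = "Sigma V (\<lambda>v. {..<f v})"
  have finP: "finite ?P" using fin by simp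
  obtain m where m: "max_matching (blow_up E) ?P m" using ex_max_matching by blast
  obtain S where S: "S \<subseteq> ?P"
    "card S + card (unmatched ?P m) \<le> card (components (blow_up E) (?P - S))"
    using berge_components[OF finP sym_blow_up[OF sym] m] by blast
  \<comment> \<open>Vertices with \<open>f v = 0\<close> have no copies and fall into
    \<open>T\<close>, where they add nothing to \<open>sum f T\<close>.\<close>
  define T where "T = {v \<in> V. {v} \<times> {..<f v} \<subseteq> S}"
  have "Sigma T (\<lambda>v. {..<f v}) \<subseteq> S" by (auto simp: T_def)
  then have "card (Sigma T (\<lambda>v. {..<f v})) \<le> card S"
    using S(1) finP by (intro card_mono) (auto intro: finite_subset)
  moreover have "card (Sigma T (\<lambda>v. {..<f v})) = sum f T"
    using fin by (subst card_SigmaI) (auto simp: T_def)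
  ultimately have "card (unmatched ?P m) \<le> 1"
    using S(2) card_components_blow_up[OF fin sym S(1) T_def] bound[of T] by (auto simp: T_def)
  moreover have "even (card (unmatched ?P m))"
    using parity_unmatched[OF finP, of "blow_up E" m] m ev fin by (simp add: max_matching_def)
  ultimately have "card (unmatched ?P m) = 0"
    by (metis le_neq_implies_less less_one odd_one)
  then have "unmatched ?P m = {}"
    using finP by (simp add: unmatched_def)
  then show ?thesis using that[of m] m by (auto simp: unmatched_def max_matching_def)
qed

theorem parity_subgraph:
  fixes f :: "'b \<Rightarrow> nat"
  assumes fin: "finite V" and sym: "sym E" and ev: "even (sum f V)"
    and bound: "\<And>T. T \<subseteq> V \<Longrightarrow> card (components E (V - T)) \<le> sum f T + 1"
  obtains H where "H \<subseteq> E" "sym H"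
    "\<And>v. v \<in> V \<Longrightarrow> card (H `` {v}) \<le> f v \<and> (even (card (H `` {v})) \<longleftrightarrow> even (f v))"
proof -
  let ?P = "Sigma V (\<lambda>v. {..<f v})"
  obtain m where m: "matching_on (blow_up E) ?P m" and nofix: "\<And>x. x \<in> ?P \<Longrightarrow> m x \<noteq> x"
    using perfect_matching_blow_up[OF assms] by blast
  have mP: "m x \<in> ?P" "m (m x) = x" "(x, m x) \<in> blow_up E" if "x \<in> ?P" for x
    using m nofix[OF that] that unfolding matching_on_def by blast+
  \<comment> \<open>The size of \<open>A u v\<close> is the multiplicity of the edge
    \<open>uv\<close> in the projected multigraph; \<open>H\<close> keeps the pairs of odd
    multiplicity.\<close>
  define A where "A u v = {i \<in> {..<f u}. fst (m (u, i)) = v}" for u v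
  define H where "H = {(u, v). u \<in> V \<and> v \<in> V \<and> odd (card (A u v))}"
  have partner: "snd (m (u, i)) \<in> A v u" "m (v, snd (m (u, i))) = (u, i)"
    if "u \<in> V" "i \<in> A u v" for u v i
  proof -
    have x: "(u, i) \<in> ?P" "m (u, i) = (v, snd (m (u, i)))" using that by (auto simp: A_def prod_eq_iff)
    then show "m (v, snd (m (u, i))) = (u, i)" using mP(2)[OF x(1)] by simp
    then show "snd (m (u, i)) \<in> A v u" using mP(1)[OF x(1)] x(2) by (auto simp: A_def)
  qed
  have sym_A: "card (A u v) = card (A v u)" if uv: "u \<in> V" "v \<in> V" for u v
  proof (rule bij_betw_same_card)
    show "bij_betw (\<lambda>i. snd (m (u, i))) (A u v) (A v u)"
      by (rule bij_betw_byWitness[where f' = "\<lambda>i. snd (m (v, i))"])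
        (use partner[OF uv(1), of _ v] partner[OF uv(2), of _ u] in auto)
  qed
  \<comment> \<open>Matched pairs within one clique project to loops; each uses two copies of
    \<open>u\<close>, so loops vanish modulo 2.\<close>
  have even_A: "even (card (A u u))" if u: "u \<in> V" for u
  proof (rule even_card_involution[where h = "\<lambda>i. snd (m (u, i))"])
    show "finite (A u u)" by (simp add: A_def)
    show "snd (m (u, i)) \<in> A u u \<and> snd (m (u, snd (m (u, i)))) = i \<and> snd (m (u, i)) \<noteq> i"
      if i: "i \<in> A u u" for i
      using partner[OF u i] nofix[of "(u, i)"] u i by (auto simp: A_def prod_eq_iff)
  qed
  have sum_A: "(\<Sum>v\<in>V. card (A u v)) = f u" if u: "u \<in> V" for u
  proof -
    have "(\<lambda>i. fst (m (u, i))) ` {..<f u} \<subseteq> V" using mP(1)[of "(u, _)"] u by force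
    from sum.group[OF _ fin this, of "\<lambda>_. 1::nat"] show ?thesis by (simp add: A_def)
  qed
  show ?thesis
  proof (rule that[of H])
    show "H \<subseteq> E"
    proof
      fix e assume "e \<in> H"
      then obtain u v where e: "e = (u, v)" "u \<in> V" "odd (card (A u v))" by (auto simp: H_def)
      then have "A u v \<noteq> {}" by (metis card.empty even_zero)
      then obtain i where i: "i \<in> A u v" by blast
      have "u \<noteq> v" using e even_A by blast
      then show "e \<in> E" using mP(3)[of "(u, i)"] i e by (auto simp: A_def blow_up_def)
    qed
    show "sym H" using sym_A by (auto simp: H_def sym_def)
    fix u assume u: "u \<in> V"
    have H: "H `` {u} = {v \<in> V. odd (card (A u v))}" using u by (auto simp: H_def)
    have "card (H `` {u}) = (\<Sum>v\<in>{v \<in> V. odd (card (A u v))}. 1)" by (simp add: H)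
    also have "\<dots> \<le> (\<Sum>v\<in>{v \<in> V. odd (card (A u v))}. card (A u v))"
      by (intro sum_mono) (auto intro!: Suc_leI odd_pos)
    also have "\<dots> \<le> (\<Sum>v\<in>V. card (A u v))" using fin by (intro sum_mono2) auto
    finally have "card (H `` {u}) \<le> f u" using sum_A[OF u] by simp
    moreover have "even (f u) \<longleftrightarrow> even (card (H `` {u}))"
      using even_sum_iff[OF fin, of "\<lambda>v. card (A u v)"] sum_A[OF u] H by simp
    ultimately show "card (H `` {u}) \<le> f u \<and> (even (card (H `` {u})) \<longleftrightarrow> even (f u))" by blast
  qed
qed

text \<open>The result is \<open>E\<close> minus a subgraph \<open>H\<close> with degrees at most
  \<open>f\<close> and of the same parity as \<open>f\<close>. Since \<open>f + g = d\<close>, the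
  remaining degrees are at least \<open>g\<close>, hence positive, and have the parity of
  \<open>g\<close>. The bound on \<open>T\<close> suffices because \<open>g\<close> is at most
  2.\<close>

theorem strong_parity_subgraph:
  fixes E :: "('b \<times> 'b) set"
  assumes fin: "finite V" and EV: "E \<subseteq> V \<times> V" and sym: "sym E" and irrefl: "irrefl E"
    and deg: "\<And>v. v \<in> V \<Longrightarrow> 2 \<le> card (E `` {v})"
    and bound: "\<And>T. T \<subseteq> V \<Longrightarrow>
      card (components E (V - T)) + 2 * card T \<le> (\<Sum>v\<in>T. card (E `` {v})) + 1"
    and X: "X \<subseteq> V" "even (card X)"
  obtains F where "F \<subseteq> E" "sym F"
    "\<And>v. v \<in> V \<Longrightarrow> 1 \<le> card (F `` {v}) \<and> (odd (card (F `` {v})) \<longleftrightarrow> v \<in> X)"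
proof -
  define d where "d v = card (E `` {v})" for v
  define g where "g v = (if v \<in> X then 1 else 2 :: nat)" for v
  define f where "f v = d v - g v" for v
  have d2: "2 \<le> d v" if "v \<in> V" for v using deg[OF that] by (simp add: d_def)
  have fg: "f v + g v = d v" if "v \<in> V" for v using d2[OF that] by (auto simp: f_def g_def)
  have finE: "finite E" using fin EV by (auto intro: finite_subset)
  \<comment> \<open>The handshake lemma: \<open>E\<close> holds both arcs of each edge, so the
    degree sum is even. With \<open>card X\<close> even, \<open>sum f V\<close> is even too.\<close>
  have "even (card E)"
  proof (rule even_card_involution[where h = prod.swap, OF finE])
    show "prod.swap e \<in> E \<and> prod.swap (prod.swap e) = e \<and> prod.swap e \<noteq> e" if "e \<in> E" for e
      using that symD[OF sym] irreflD[OF irrefl] by (cases e) auto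
  qed
  moreover have "card E = (\<Sum>v\<in>V. d v)"
  proof -
    have "E = Sigma V (\<lambda>v. E `` {v})" using EV by auto
    moreover have "card (Sigma V (\<lambda>v. E `` {v})) = (\<Sum>v\<in>V. d v)"
      unfolding d_def using fin finite_Image[OF finE] by (intro card_SigmaI) auto
    ultimately show ?thesis by simp
  qed
  moreover have "(\<Sum>v\<in>V. d v) = sum f V + sum g V"
    using fg by (simp add: sum.distrib[symmetric])
  moreover have "even (sum g V)"
  proof -
    have "{v \<in> V. odd (g v)} = X" using X by (auto simp: g_def)
    then show ?thesis using even_sum_iff[OF fin, of g] X by simp
  qed
  ultimately have ev: "even (sum f V)" by simp
  have "card (components E (V - T)) \<le> sum f T + 1" if T: "T \<subseteq> V" for T
  proof -
    have "(\<Sum>v\<in>T. d v) = sum f T + sum g T" using fg T by (simp add: sum.distrib[symmetric] subset_iff)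
    moreover have "sum g T \<le> 2 * card T"
      using sum_bounded_above[of T g 2] by (simp add: g_def mult.commute)
    ultimately show ?thesis using bound[OF T] by (simp add: d_def)
  qed
  from parity_subgraph[OF fin sym ev this] obtain H where H: "H \<subseteq> E" "sym H"
    "\<And>v. v \<in> V \<Longrightarrow> card (H `` {v}) \<le> f v \<and> (even (card (H `` {v})) \<longleftrightarrow> even (f v))" by blast
  show ?thesis
  proof (rule that[of "E - H"])
    show "E - H \<subseteq> E" by blast
    show "sym (E - H)" using sym H(2) by (auto simp: sym_def)
    fix v assume v: "v \<in> V"
    have "(E - H) `` {v} = E `` {v} - H `` {v}" by auto
    moreover have "H `` {v} \<subseteq> E `` {v}" using H by blast
    moreover have "finite (E `` {v})" using finE by (rule finite_Image)
    ultimately have "card ((E - H) `` {v}) + card (H `` {v}) = f v + g v"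
      unfolding fg[OF v] d_def
      by (metis card_Diff_subset card_mono finite_subset le_add_diff_inverse2)
    then show "1 \<le> card ((E - H) `` {v}) \<and> (odd (card ((E - H) `` {v})) \<longleftrightarrow> v \<in> X)"
      using H(3)[OF v] unfolding g_def by (auto split: if_splits) presburger+
  qed
qed

subsection \<open>Vertex sets with many components\<close>

lemma components_subset: "C \<in> components E W \<Longrightarrow> C \<subseteq> W"
proof -
  assume "C \<in> components E W"
  then obtain x where x: "x \<in> W" "C = (Restr E W)\<^sup>* `` {x}" by (auto simp: components_def elim: quotientE)
  have "y \<in> W" if "(x, y) \<in> (Restr E W)\<^sup>*" for y
    using that x(1) by (induction rule: rtrancl_induct) auto
  then show ?thesis using x(2) by blast
qed

lemma components_nonempty: "C \<in> components E W \<Longrightarrow> C \<noteq> {}"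
  by (auto simp: components_def elim!: quotientE)

lemma Union_components: "\<Union> (components E W) = W"
proof
  show "\<Union> (components E W) \<subseteq> W" using components_subset by blast
  show "W \<subseteq> \<Union> (components E W)" by (force simp: components_def quotient_def)
qed

lemma components_closed:
  "C \<in> components E W \<Longrightarrow> x \<in> C \<Longrightarrow> y \<in> W \<Longrightarrow> (x, y) \<in> E \<Longrightarrow> y \<in> C"
  using components_subset[of C E W]
  by (auto simp: components_def elim!: quotientE intro: rtrancl_into_rtrancl)

lemma components_disjoint:
  assumes "sym E" "C \<in> components E W" "D \<in> components E W" "C \<noteq> D"
  shows "C \<inter> D = {}"
proof (rule ccontr)
  let ?R = "(Restr E W)\<^sup>*"
  assume "C \<inter> D \<noteq> {}"
  then obtain x y z where C: "C = ?R `` {x}" and D: "D = ?R `` {y}" and z: "(x, z) \<in> ?R" "(y, z) \<in> ?R"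
    using assms(2,3) by (auto simp: components_def elim!: quotientE)
  then have z': "(z, x) \<in> ?R" "(z, y) \<in> ?R"
    using sym_rtrancl_Restr[OF assms(1), of W] by (auto dest: symD)
  have "(x, y) \<in> ?R" "(y, x) \<in> ?R" using z z' by (auto intro: rtrancl_trans)
  then have "C = D" unfolding C D by (auto intro: rtrancl_trans)
  then show False using assms(4) by simp
qed

lemma card_components_partition:
  assumes "finite W" "sym E"
  shows "(\<Sum>C\<in>components E W. card C) = card W"
proof -
  have "card (\<Union> (components E W)) = (\<Sum>C\<in>components E W. card C)"
    using components_disjoint[OF assms(2)] finite_subset[OF components_subset assms(1)]
    by (intro card_Union_disjoint) (auto simp: pairwise_def disjnt_def)
  then show ?thesis by (simp add: Union_components)
qed

text \<open>A component of at most \<open>\<delta>\<close> vertices sends at least \<open>\<delta>\<close> edges to \<open>T\<close>, so deficiency leaves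
  room for fewer than \<open>card T\<close> such components (the set \<open>A\<close>) and forces at least \<open>\<delta>\<close> larger
  ones (the set \<open>B\<close>).\<close>

theorem degree_bound_of_deficient_set:
  fixes E :: "('b \<times> 'b) set" and \<delta> :: nat
  assumes fin: "finite V" and EV: "E \<subseteq> V \<times> V" and sym: "sym E" and irrefl: "irrefl E"
    and conn: "\<And>C. C \<subseteq> V \<Longrightarrow> C \<noteq> {} \<Longrightarrow> C \<noteq> V \<Longrightarrow> \<exists>x\<in>C. \<exists>y\<in>V - C. (x, y) \<in> E"
    and deg: "\<And>v. v \<in> V \<Longrightarrow> \<delta> \<le> card (E `` {v})"
    and \<delta>: "3 \<le> \<delta>" and order: "2 * \<delta>\<^sup>2 \<le> card V"
    and T: "T \<subseteq> V"
    and deficient: "(\<Sum>v\<in>T. card (E `` {v})) + 2 \<le> card (components E (V - T)) + 2 * card T"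
    and v: "v \<in> V"
  shows "card (E `` {v}) + \<delta>\<^sup>2 \<le> card V"
proof -
  let ?K = "components E (V - T)"
  define s where "s = (\<Sum>v\<in>T. card (E `` {v}))"
  \<comment> \<open>\<open>e C\<close> counts the edges between \<open>C\<close> and
    \<open>T\<close>, from the side of \<open>T\<close>; \<open>e_sym\<close> recounts them from the
    side of \<open>C\<close>.\<close>
  define e where "e C = (\<Sum>y\<in>T. card (E `` {y} \<inter> C))" for C
  define A where "A = {C \<in> ?K. card C \<le> \<delta>}"
  define B where "B = {C \<in> ?K. \<not> card C \<le> \<delta>}"
  have finT: "finite T" using T fin by (rule finite_subset)
  have finE: "finite (E `` {x})" for x using EV by (intro finite_subset[OF _ fin]) auto
  have finK: "finite ?K" using fin by (simp add: finite_components)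
  have finC: "finite C" if "C \<in> ?K" for C
    using components_subset[OF that] fin by (auto intro: finite_subset)
  have AB: "?K = A \<union> B" "A \<inter> B = {}" "finite A" "finite B"
    using finK by (auto simp: A_def B_def)
  have cK: "card ?K = card A + card B" using AB by (simp add: card_Un_disjoint)
  have T_ne: "T \<noteq> {}"
  proof
    assume "T = {}"
    then have "2 \<le> card (components E V)" using deficient by simp
    then obtain C D where CD: "C \<in> components E V" "D \<in> components E V" "C \<noteq> D"
      using card_le_Suc0_iff_eq[of "components E V"] fin
      by (metis finite_components not_less_eq_eq numeral_2_eq_2)
    then have "C \<noteq> V"
      using components_disjoint[OF sym CD] components_subset[OF CD(2)] components_nonempty[OF CD(2)] by blast
    then show False
      using conn[OF components_subset[OF CD(1)] components_nonempty[OF CD(1)]]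
        components_closed[OF CD(1)] by blast
  qed
  have e_sym: "e C = (\<Sum>x\<in>C. card (E `` {x} \<inter> T))" if "C \<in> ?K" for C
  proof -
    have c: "card (E `` {x} \<inter> S) = (\<Sum>y\<in>S. of_bool ((x, y) \<in> E))" if "finite S" for x S
    proof -
      have "S \<inter> {y. (x, y) \<in> E} = E `` {x} \<inter> S" by auto
      then show ?thesis using that by (simp add: sum_of_bool_eq)
    qed
    have "e C = (\<Sum>y\<in>T. \<Sum>x\<in>C. of_bool ((y, x) \<in> E))" unfolding e_def by (simp add: c finC that)
    also have "\<dots> = (\<Sum>x\<in>C. \<Sum>y\<in>T. of_bool ((y, x) \<in> E))" by (rule sum.swap)
    also have "\<dots> = (\<Sum>x\<in>C. \<Sum>y\<in>T. of_bool ((x, y) \<in> E))"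
      using sym by (intro sum.cong refl arg_cong[of _ _ of_bool]) (auto dest: symD)
    finally show ?thesis by (simp add: c finT)
  qed
  have nbrs: "E `` {x} \<subseteq> (C - {x}) \<union> (E `` {x} \<inter> T)" if "C \<in> ?K" "x \<in> C" for C x
    using components_closed[OF that] EV irreflD[OF irrefl] by blast
  have deg_le: "card (E `` {x}) + 1 \<le> card C + card (E `` {x} \<inter> T)" if C: "C \<in> ?K" "x \<in> C" for C x
  proof -
    have "card (E `` {x}) \<le> card (C - {x}) + card (E `` {x} \<inter> T)"
      using card_mono[OF _ nbrs[OF C]] card_Un_le[of "C - {x}" "E `` {x} \<inter> T"] finC[OF C(1)] finT
      by fastforce
    moreover have "card C = Suc (card (C - {x}))"
      using C finC by (metis card_Suc_Diff1)
    ultimately show ?thesis by simp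
  qed
  have e_pos: "1 \<le> e C" if C: "C \<in> ?K" for C
  proof -
    have "C \<noteq> V" "C \<subseteq> V" using components_subset[OF C] T T_ne by blast+
    then obtain x y where xy: "x \<in> C" "y \<in> V - C" "(x, y) \<in> E"
      using conn components_nonempty[OF C] by metis
    then have "y \<in> T" using components_closed[OF C xy(1) _ xy(3)] by blast
    then have "E `` {x} \<inter> T \<noteq> {}" using xy by blast
    then have "0 < card (E `` {x} \<inter> T)" using finT by (simp add: card_gt_0_iff)
    also have "\<dots> \<le> e C" unfolding e_sym[OF C] using xy(1) finC[OF C] by (intro member_le_sum) auto
    finally show ?thesis by simp
  qed
  have e_small: "\<delta> \<le> e C" if "C \<in> A" for C
  proof -
    have C: "C \<in> ?K" "card C \<le> \<delta>" using that by (auto simp: A_def)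
    have "0 < card C" using components_nonempty[OF C(1)] finC[OF C(1)] by (simp add: card_gt_0_iff)
    \<comment> \<open>With \<open>p + 1\<close> vertices in \<open>C\<close> and \<delta> =
      \<open>p + 1 + q\<close>, each vertex of \<open>C\<close> has at most \<open>p\<close>
      neighbours in \<open>C\<close>, hence at least \<open>q + 1\<close> in \<open>T\<close>. The
      product \<open>(p + 1) * (q + 1)\<close> is at least \<open>p + q + 1\<close>.\<close>
    then obtain p where p: "card C = Suc p" using gr0_implies_Suc by blast
    then obtain q where q: "\<delta> = Suc p + q" using C(2) by (metis le_Suc_ex)
    have "Suc q \<le> card (E `` {x} \<inter> T)" if x: "x \<in> C" for x
    proof -
      have "x \<in> V" using components_subset[OF C(1)] x by blast
      then show ?thesis using deg_le[OF C(1) x] deg[of x] p q by linarith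
    qed
    then have "card C * Suc q \<le> e C" unfolding e_sym[OF C(1)]
      using sum_bounded_below[of C "Suc q" "\<lambda>x. card (E `` {x} \<inter> T)"] by simp
    moreover have "\<delta> \<le> card C * Suc q" by (simp add: p q)
    ultimately show ?thesis by simp
  qed
  have "card A * \<delta> + card B \<le> (\<Sum>C\<in>A. e C) + (\<Sum>C\<in>B. e C)"
    using sum_bounded_below[of A \<delta> e] sum_bounded_below[of B 1 e] e_small e_pos
    by (auto simp: B_def intro!: add_mono)
  also have "\<dots> = (\<Sum>C\<in>?K. e C)" using AB by (simp add: sum.union_disjoint)
  also have "\<dots> = (\<Sum>y\<in>T. \<Sum>C\<in>?K. card (E `` {y} \<inter> C))" unfolding e_def by (rule sum.swap)
  also have "\<dots> \<le> s"
    unfolding s_def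
  proof (rule sum_mono)
    fix y assume "y \<in> T"
    have "(\<Sum>C\<in>?K. card (E `` {y} \<inter> C)) = card (\<Union>C\<in>?K. E `` {y} \<inter> C)"
      using components_disjoint[OF sym] finK finE by (intro card_UN_disjoint[symmetric]) blast+
    also have "\<dots> \<le> card (E `` {y})" using finE by (intro card_mono) auto
    finally show "(\<Sum>C\<in>?K. card (E `` {y} \<inter> C)) \<le> card (E `` {y})" .
  qed
  finally have out: "card A * \<delta> + card B \<le> s" .
  have s: "s + 2 \<le> card A + card B + 2 * card T" using deficient cK by (simp add: s_def)
  obtain k where k: "card T = Suc k" using T_ne finT by (metis card_gt_0_iff gr0_implies_Suc)
  have "card A * 3 \<le> card A * \<delta>" using \<delta> by simp
  \<comment> \<open>With \<open>a = card A\<close> and \<open>b = card B\<close>,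
    \<open>3 * a + b\<close> is at most \<open>s\<close>, which is at most
    \<open>a + b + 2 * k\<close>.\<close>
  then have Ak: "card A \<le> k" using out s k by linarith
  have "card T * \<delta> \<le> s" unfolding s_def
    using sum_bounded_below[of T \<delta> "\<lambda>v. card (E `` {v})"] deg T by auto
  moreover have \<delta>k: "3 * k \<le> \<delta> * k" using \<delta> by simp
  moreover have "card T * \<delta> = \<delta> + \<delta> * k" by (simp add: k mult.commute)
  \<comment> \<open>The degrees in \<open>T\<close> sum to at least
    \<delta>\<open>* (k + 1)\<close>, while \<open>s\<close> is at most
    \<open>3 * k + card B\<close>; \<delta> \<ge> 3 cancels the terms in \<open>k\<close>.\<close>
  ultimately have B: "\<delta> \<le> card B" using s k Ak by linarith
  have sizes: "card V = card T + (\<Sum>C\<in>?K. card C)"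
    using card_components_partition[of "V - T" E] fin sym T finT
    by (simp add: card_Diff_subset card_mono)
  have big: "card D * Suc \<delta> \<le> (\<Sum>C\<in>D. card C)" if "D \<subseteq> B" for D
  proof -
    have "Suc \<delta> \<le> card C" if "C \<in> D" for C
      using that \<open>D \<subseteq> B\<close> by (auto simp: B_def)
    from sum_bounded_below[of D "Suc \<delta>" card, OF this] show ?thesis by simp
  qed
  show ?thesis
  proof (cases "v \<in> T")
    case True
    have "s = card (E `` {v}) + (\<Sum>y\<in>T - {v}. card (E `` {y}))"
      unfolding s_def using finT True by (rule sum.remove)
    moreover have "card (T - {v}) * \<delta> \<le> (\<Sum>y\<in>T - {v}. card (E `` {y}))"
      using sum_bounded_below[of "T - {v}" \<delta> "\<lambda>v. card (E `` {v})"] deg T by auto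
    moreover have "card (T - {v}) * \<delta> = \<delta> * k" using k True by (simp add: mult.commute)
    \<comment> \<open>The other \<open>k\<close> vertices of \<open>T\<close> already use
      \<delta>\<open>* k\<close> of \<open>s\<close>. As each member of \<open>B\<close> has at
      least four vertices, the degree of \<open>v\<close> is at most a quarter of the order, and
      \<delta> squared is at most half.\<close>
    ultimately have "card (E `` {v}) \<le> card B" using s k Ak \<delta>k by linarith
    moreover have "card B * Suc \<delta> \<le> card V"
      using big[of B] sum_mono2[OF finK, of B card] sizes by (auto simp: B_def)
    moreover have "card B * 4 \<le> card B * Suc \<delta>" using \<delta> by (intro mult_le_mono2) simp
    ultimately show ?thesis using order by linarith
  next
    case False
    then obtain C where C: "C \<in> ?K" "v \<in> C" using v Union_components[of E "V - T"] by blast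
    have "card (E `` {v} \<inter> T) \<le> card T" using finT by (simp add: card_mono)
    then have d: "card (E `` {v}) + 1 \<le> card C + card T" using deg_le[OF C] by simp
    have "(\<Sum>D\<in>?K. card D) = card C + (\<Sum>D\<in>?K - {C}. card D)" using finK C(1) by (rule sum.remove)
    moreover have "card (B - {C}) * Suc \<delta> \<le> (\<Sum>D\<in>?K - {C}. card D)"
    proof (rule order_trans[OF big])
      show "(\<Sum>D\<in>B - {C}. card D) \<le> (\<Sum>D\<in>?K - {C}. card D)"
        using finK by (intro sum_mono2) (auto simp: B_def)
    qed blast
    \<comment> \<open>At least \<delta>\<open>- 1\<close> large components avoid \<open>C\<close>,
      each with at least \<delta>\<open>+ 1\<close> vertices; none of these vertices is adjacent to
      \<open>v\<close>.\<close>
    moreover have "(\<delta> - 1) * Suc \<delta> \<le> card (B - {C}) * Suc \<delta>"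
      using B diff_card_le_card_Diff[of "{C}" B] by (intro mult_le_mono1) simp
    moreover have "(\<delta> - 1) * Suc \<delta> + 1 = \<delta>\<^sup>2"
      using \<delta> by (cases \<delta>) (auto simp: power2_eq_square)
    ultimately show ?thesis using d sizes by linarith
  qed
qed

subsection \<open>Spectral radius\<close>

text \<open>Ensures that \<open>Max\<close> is taken over a nonempty spectrum. A complex eigenvalue
  \<open>k\<close> exists; the Hermitian form \<open>q\<close> is real and equals \<open>k\<close>
  times the positive number \<open>s\<close>, so \<open>k\<close> is real and is a root of the real
  characteristic polynomial.\<close>

lemma symmetric_real_spectrum_nonempty:
  fixes A :: "real mat"
  assumes A: "A \<in> carrier_mat n n" and n: "0 < n"
    and sym: "\<And>i j. i < n \<Longrightarrow> j < n \<Longrightarrow> A $$ (i, j) = A $$ (j, i)"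
  shows "spectrum A \<noteq> {}"
proof -
  let ?C = "map_mat complex_of_real A"
  have C: "?C \<in> carrier_mat n n" using A by simp
  obtain k where k: "eigenvalue ?C k" using spectrum_non_empty[OF C n] by (auto simp: spectrum_def)
  then obtain z where z: "z \<in> carrier_vec n" "z \<noteq> 0\<^sub>v n" "?C *\<^sub>v z = k \<cdot>\<^sub>v z"
    using A by (auto simp: eigenvalue_def eigenvector_def)
  define s where "s = (\<Sum>i<n. (cmod (z $ i))\<^sup>2)"
  define q where "q = (\<Sum>i<n. \<Sum>j<n. complex_of_real (A $$ (i, j)) * z $ j * cnj (z $ i))"
  have row: "(\<Sum>j<n. complex_of_real (A $$ (i, j)) * z $ j) = k * z $ i" if "i < n" for i
  proof -
    have "(?C *\<^sub>v z) $ i = (\<Sum>j<n. complex_of_real (A $$ (i, j)) * z $ j)"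
      using A z(1) that by (auto simp: scalar_prod_def atLeast0LessThan intro!: sum.cong)
    then show ?thesis using z that by simp
  qed
  have "q = (\<Sum>i<n. k * z $ i * cnj (z $ i))"
    unfolding q_def by (intro sum.cong refl) (simp add: row[symmetric] sum_distrib_right)
  also have "\<dots> = k * of_real s"
    by (simp add: s_def sum_distrib_left mult.assoc complex_norm_square del: of_real_power)
  finally have q: "q = k * of_real s" .
  have "cnj q = (\<Sum>i<n. \<Sum>j<n. complex_of_real (A $$ (j, i)) * z $ i * cnj (z $ j))"
    unfolding q_def cnj_sum by (intro sum.cong refl) (simp add: sym mult_ac)
  also have "\<dots> = q" unfolding q_def by (rule sum.swap)
  finally have "cnj k * of_real s = k * of_real s" using q by simp
  moreover have "s \<noteq> 0"
  proof
    assume "s = 0"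
    then have "\<forall>i<n. z $ i = 0" by (simp add: s_def sum_nonneg_eq_0_iff)
    then show False using z(1,2) by (auto intro: eq_vecI)
  qed
  ultimately have "cnj k = k" by simp
  then obtain r where r: "k = of_real r" by (metis Reals_cnj_iff Reals_cases)
  have "poly (map_poly complex_of_real (char_poly A)) (of_real r) = 0"
    using k r by (simp add: eigenvalue_root_char_poly[OF C] of_real_hom.char_poly_hom[OF A])
  then have "eigenvalue A r" by (simp add: eigenvalue_root_char_poly[OF A])
  then show ?thesis by (auto simp: spectrum_def)
qed

lemma bij_vertex_enum:
  assumes "finite (pverts G)"
  shows "bij_betw (vertex_enum G) {..<card (pverts G)} (pverts G)"
  using ex_bij_betw_nat_finite[OF assms] unfolding vertex_enum_def atLeast0LessThan by (rule someI_ex)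

lemma adjacency_matrix_carrier:
  "adjacency_matrix G \<in> carrier_mat (card (pverts G)) (card (pverts G))"
  by (simp add: adjacency_matrix_def)

text \<open>Replaces vectors by functions on the vertices, so that the chosen enumeration disappears
  from all later arguments.\<close>

lemma spectrum_adjacency_matrix_iff:
  assumes fin: "finite (pverts G)"
  shows "\<mu> \<in> spectrum (adjacency_matrix G) \<longleftrightarrow>
    (\<exists>x. (\<exists>v\<in>pverts G. x v \<noteq> 0) \<and>
      (\<forall>v\<in>pverts G. (\<Sum>u\<in>pverts G. if (v, u) \<in> parcs G then x u else 0) = \<mu> * x v))"
proof -
  let ?n = "card (pverts G)" and ?f = "vertex_enum G" and ?A = "adjacency_matrix G"
  note bij = bij_vertex_enum[OF fin]
  have fV: "?f i \<in> pverts G" if "i < ?n" for i using bij that by (auto simp: bij_betw_def)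
  have onto: "\<exists>i<?n. v = ?f i" if "v \<in> pverts G" for v using bij that by (auto simp: bij_betw_def)
  have row: "(?A *\<^sub>v w) $ i = (\<Sum>u\<in>pverts G. if (?f i, u) \<in> parcs G then x u else 0)"
    if i: "i < ?n" and w: "w \<in> carrier_vec ?n" and x: "\<And>j. j < ?n \<Longrightarrow> x (?f j) = w $ j" for i w x
  proof -
    have "(?A *\<^sub>v w) $ i = (\<Sum>j<?n. if (?f i, ?f j) \<in> parcs G then x (?f j) else 0)"
      using i w x by (auto simp: adjacency_matrix_def scalar_prod_def atLeast0LessThan intro!: sum.cong)
    also have "\<dots> = (\<Sum>u\<in>pverts G. if (?f i, u) \<in> parcs G then x u else 0)"
      by (rule sum.reindex_bij_betw[OF bij])
    finally show ?thesis .
  qed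
  have dim: "dim_row ?A = ?n" by (simp add: adjacency_matrix_def)
  show ?thesis
  proof
    assume "\<mu> \<in> spectrum ?A"
    then obtain w where w: "w \<in> carrier_vec ?n" "w \<noteq> 0\<^sub>v ?n" "?A *\<^sub>v w = \<mu> \<cdot>\<^sub>v w"
      by (auto simp: spectrum_def eigenvalue_def eigenvector_def dim)
    define x where "x v = w $ (inv_into {..<?n} ?f v)" for v
    have x: "x (?f j) = w $ j" if "j < ?n" for j
      using bij that by (simp add: x_def bij_betw_def inv_into_f_f)
    obtain i where i: "i < ?n" "w $ i \<noteq> 0" using w(1,2) by (metis carrier_vecD eq_vecI index_zero_vec)
    then have "\<exists>v\<in>pverts G. x v \<noteq> 0" using x fV by metis
    moreover have "(\<Sum>u\<in>pverts G. if (v, u) \<in> parcs G then x u else 0) = \<mu> * x v"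
      if v: "v \<in> pverts G" for v
    proof -
      obtain i where i: "i < ?n" "v = ?f i" using onto[OF v] by blast
      show ?thesis using row[OF i(1) w(1) x] w i x by simp
    qed
    ultimately show "\<exists>x. (\<exists>v\<in>pverts G. x v \<noteq> 0) \<and>
      (\<forall>v\<in>pverts G. (\<Sum>u\<in>pverts G. if (v, u) \<in> parcs G then x u else 0) = \<mu> * x v)" by blast
  next
    assume "\<exists>x. (\<exists>v\<in>pverts G. x v \<noteq> 0) \<and>
      (\<forall>v\<in>pverts G. (\<Sum>u\<in>pverts G. if (v, u) \<in> parcs G then x u else 0) = \<mu> * x v)"
    then obtain x v where x: "v \<in> pverts G" "x v \<noteq> 0"
      "\<And>v. v \<in> pverts G \<Longrightarrow> (\<Sum>u\<in>pverts G. if (v, u) \<in> parcs G then x u else 0) = \<mu> * x v"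
      by blast
    define w where "w = vec ?n (\<lambda>i. x (?f i))"
    have w: "w \<in> carrier_vec ?n" "\<And>j. j < ?n \<Longrightarrow> x (?f j) = w $ j" by (auto simp: w_def)
    obtain i where "i < ?n" "v = ?f i" using onto[OF x(1)] by blast
    then have "w $ i \<noteq> 0\<^sub>v ?n $ i" using x(2) w(2) by simp
    then have "w \<noteq> 0\<^sub>v ?n" by metis
    moreover have "?A *\<^sub>v w = \<mu> \<cdot>\<^sub>v w"
    proof (rule eq_vecI)
      show "(?A *\<^sub>v w) $ i = (\<mu> \<cdot>\<^sub>v w) $ i" if "i < dim_vec (\<mu> \<cdot>\<^sub>v w)" for i
      proof -
        have i: "i < ?n" using that by (simp add: w_def)
        then show ?thesis using row[OF i w] x(3)[OF fV[OF i]] by (simp add: w_def)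
      qed
    qed (simp add: w_def dim)
    ultimately show "\<mu> \<in> spectrum ?A"
      using w by (auto simp: spectrum_def eigenvalue_def eigenvector_def dim)
  qed
qed

lemma graph_spectral_radius_ge:
  assumes "\<mu> \<in> spectrum (adjacency_matrix G)"
  shows "\<mu> \<le> graph_spectral_radius G"
  unfolding graph_spectral_radius_def
  using assms card_finite_spectrum(1)[OF adjacency_matrix_carrier] by (rule Max_ge[rotated])

text \<open>Evaluate the eigenvalue equation at a vertex where the eigenvector has largest absolute
  value.\<close>

lemma graph_spectral_radius_le_max_degree:
  assumes G: "pair_graph G" and ne: "pverts G \<noteq> {}"
    and deg: "\<And>v. v \<in> pverts G \<Longrightarrow> card (parcs G `` {v}) \<le> D"
  shows "graph_spectral_radius G \<le> D"
proof -
  let ?A = "adjacency_matrix G"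
  note [simp] = pair_graphD(1)[OF G]
  have bound: "\<mu> \<le> D" if \<mu>: "\<mu> \<in> spectrum ?A" for \<mu>
  proof -
    obtain x w where w: "w \<in> pverts G" "x w \<noteq> 0"
      and x: "\<And>v. v \<in> pverts G \<Longrightarrow> (\<Sum>u\<in>pverts G. if (v, u) \<in> parcs G then x u else 0) = \<mu> * x v"
      using \<mu> unfolding spectrum_adjacency_matrix_iff[OF pair_graphD(1)[OF G]] by blast
    define M where "M = Max ((\<lambda>v. \<bar>x v\<bar>) ` pverts G)"
    have M: "\<bar>x u\<bar> \<le> M" if "u \<in> pverts G" for u using that by (simp add: M_def)
    have "M \<in> (\<lambda>v. \<bar>x v\<bar>) ` pverts G" unfolding M_def using ne by (intro Max_in) auto
    then obtain v where v: "v \<in> pverts G" "\<bar>x v\<bar> = M" by auto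
    have "0 < M" using M[OF w(1)] w(2) by linarith
    have "\<mu> * M \<le> \<bar>\<mu> * x v\<bar>" using v by (simp add: abs_mult mult_right_mono)
    also have "\<dots> = \<bar>\<Sum>u\<in>pverts G. if (v, u) \<in> parcs G then x u else 0\<bar>" using x[OF v(1)] by simp
    also have "\<dots> \<le> (\<Sum>u\<in>pverts G. \<bar>if (v, u) \<in> parcs G then x u else 0\<bar>)" by (rule sum_abs)
    also have "\<dots> \<le> (\<Sum>u\<in>pverts G. if (v, u) \<in> parcs G then M else 0)"
      using M by (intro sum_mono) auto
    also have "\<dots> = real (card (pverts G \<inter> {u. (v, u) \<in> parcs G})) * M" by (simp add: sum.If_cases)
    also have "pverts G \<inter> {u. (v, u) \<in> parcs G} = parcs G `` {v}"
      using pair_graphD(2)[OF G] by auto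
    also have "real (card (parcs G `` {v})) * M \<le> real D * M"
      using deg[OF v(1)] \<open>0 < M\<close> by simp
    finally show "\<mu> \<le> D" using \<open>0 < M\<close> by simp
  qed
  have "spectrum ?A \<noteq> {}"
  proof (rule symmetric_real_spectrum_nonempty[OF adjacency_matrix_carrier])
    show "0 < card (pverts G)" using ne by (simp add: card_gt_0_iff)
    show "?A $$ (i, j) = ?A $$ (j, i)" if "i < card (pverts G)" "j < card (pverts G)" for i j
      using that pair_graphD(3)[OF G] by (auto simp: adjacency_matrix_def dest: symD)
  qed
  then have "Max (spectrum ?A) \<in> spectrum ?A"
    using card_finite_spectrum(1)[OF adjacency_matrix_carrier] by (intro Max_in)
  then show ?thesis unfolding graph_spectral_radius_def by (rule bound)
qed

text \<open>An eigenvector of the extremal graph that is constant on the three blocks exists exactly when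
  the eigenvalue is a root of the cubic \<open>h\<close>.\<close>

lemma graph_spectral_radius_extremal_graph:
  assumes d: "3 \<le> d" and n: "2 * d\<^sup>2 \<le> n"
  shows "real n - real d ^ 2 + 2 * real d - 2 \<le> graph_spectral_radius (extremal_graph n d)"
proof -
  define m where "m = n - d * (d - 1) - 1"
  define c where "c = d * (d - 2) + 1"
  define h where "h t = (t - (real d - 1)) * (t - real m + 1) * t - real m * real d * t
    - real c * real d * (t - real m + 1)" for t
  have "d * (d - 1) + d = d\<^sup>2" using d by (cases d) (auto simp: power2_eq_square)
  moreover have "9 \<le> d\<^sup>2" using d power_mono[of 3 d 2] by simp
  ultimately have "n = m + d * (d - 1) + 1" using n unfolding m_def by linarith
  then have "real n = real m + real d * (real d - 1) + 1" using d by (simp add: of_nat_diff)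
  then have m: "real m + d - 1 = real n - real d ^ 2 + 2 * real d - 2"
    by (simp add: power2_eq_square algebra_simps)
  \<comment> \<open>As \<open>m + d + c = n\<close>, these are the spectral radii of the complete
    graphs on \<open>m + d\<close> and on \<open>n\<close> vertices; a sign change of
    \<open>h\<close> between them yields an eigenvalue.\<close>
  let ?a = "real m + d - 1" and ?b = "real m + d + c - 1"
  have "h ?a = - (c * d * real d)" by (simp add: h_def algebra_simps)
  then have ha: "h ?a \<le> 0" by simp
  have "h ?b = ?b * (m * real c + c * d + real c * c) - c * d * (real d + c)"
    by (simp add: h_def algebra_simps)
  also have "\<dots> = c * (?b * (real m + d + c) - d * (real d + c))" by (simp add: algebra_simps)
  finally have hb': "h ?b = c * (?b * (real m + d + c) - d * (real d + c))" .
  have c1: "1 \<le> real c" by (simp add: c_def)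
  have "d * (real d + c) \<le> ?b * (real m + d + c)" using d c1 by (intro mult_mono) auto
  then have hb: "0 \<le> h ?b" unfolding hb' by simp
  have "continuous_on {?a..?b} h" unfolding h_def by (intro continuous_intros)
  then obtain t where t: "?a \<le> t" "h t = 0"
    using IVT'[of h ?a 0 ?b] ha hb by auto
  have t_pos: "0 < t" using t(1) d by simp
  let ?G = "extremal_graph n d"
  \<comment> \<open>These values solve the equations of the two blocks outside the first, with
    denominators cleared; the equation of the first block then reads \<open>h t = 0\<close>. The
    first value is nonzero because \<open>t\<close> exceeds \<open>m - 1\<close>.\<close>
  define x where "x = case_sum (\<lambda>_::nat. t * (t - real m + 1))
    (case_sum (\<lambda>_::nat. real d * t) (\<lambda>_::nat \<times> nat. real d * (t - real m + 1)))"
  have verts: "pverts ?G = {..<d} <+> ({..<m} <+> ({..<c} \<times> {..<1}))"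
    by (simp add: extremal_graph_def graph_join_def disjoint_union_def copies_def complete_graph_def
        m_def c_def)
  have fin: "finite (pverts ?G)" by (simp add: verts)
  have cnt: "(\<Sum>j<k. if i \<noteq> j then y else 0) = (real k - 1) * y" if "i < k" for i k :: nat and y :: real
  proof -
    have "{..<k} \<inter> {j. i \<noteq> j} = {..<k} - {i}" by auto
    then show ?thesis using that by (simp add: sum.If_cases of_nat_diff)
  qed
  have adj:
    "(Inl i, Inl j) \<in> parcs ?G \<longleftrightarrow> i < d \<and> j < d \<and> i \<noteq> j"
    "(Inl i, Inr b) \<in> parcs ?G \<longleftrightarrow> Inl i \<in> pverts ?G \<and> Inr b \<in> pverts ?G"
    "(Inr b, Inl i) \<in> parcs ?G \<longleftrightarrow> Inl i \<in> pverts ?G \<and> Inr b \<in> pverts ?G"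
    "(Inr (Inl k), Inr (Inl l)) \<in> parcs ?G \<longleftrightarrow> k < m \<and> l < m \<and> k \<noteq> l"
    "(Inr (Inl k), Inr (Inr p)) \<notin> parcs ?G"
    "(Inr (Inr p), Inr (Inl k)) \<notin> parcs ?G"
    "(Inr (Inr p), Inr (Inr r)) \<notin> parcs ?G" for i j k l b p r
    by (auto simp: extremal_graph_def graph_join_def disjoint_union_def copies_def complete_graph_def
        m_def c_def)
  have "t \<in> spectrum (adjacency_matrix ?G)"
    unfolding spectrum_adjacency_matrix_iff[OF fin]
  proof (intro exI[of _ x] conjI ballI)
    have "Inl 0 \<in> pverts ?G" "x (Inl 0) \<noteq> 0" using d t_pos t(1) by (auto simp: verts x_def)
    then show "\<exists>v\<in>pverts ?G. x v \<noteq> 0" by blast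
    fix v assume v: "v \<in> pverts ?G"
    have split: "(\<Sum>u\<in>pverts ?G. g u) = (\<Sum>i<d. g (Inl i)) + ((\<Sum>k<m. g (Inr (Inl k)))
      + (\<Sum>p\<in>{..<c} \<times> {..<1}. g (Inr (Inr p))))" for g :: "nat + nat + nat \<times> nat \<Rightarrow> real"
      unfolding verts by (simp add: sum.Plus o_def)
    consider i where "i < d" "v = Inl i" | k where "k < m" "v = Inr (Inl k)"
      | p where "p \<in> {..<c} \<times> {..<1}" "v = Inr (Inr p)"
      using v unfolding verts by blast
    then show "(\<Sum>u\<in>pverts ?G. if (v, u) \<in> parcs ?G then x u else 0) = t * x v"
    proof cases
      case 1
      have "(\<Sum>u\<in>pverts ?G. if (v, u) \<in> parcs ?G then x u else 0) =
        (\<Sum>j<d. if i \<noteq> j then t * (t - real m + 1) else 0)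
        + ((\<Sum>k<m. d * t) + (\<Sum>p\<in>{..<c} \<times> {..<1::nat}. d * (t - real m + 1)))"
        unfolding split 1(2)
        by (intro arg_cong2[of _ _ _ _ "(+)"] sum.cong refl) (use 1(1) in \<open>auto simp: adj verts x_def\<close>)
      also have "\<dots> = (real d - 1) * (t * (t - m + 1)) + (m * (d * t) + c * (d * (t - m + 1)))"
        using 1(1) by (simp add: cnt)
      also have "\<dots> = t * x v - h t" using d by (simp add: 1(2) x_def h_def algebra_simps of_nat_diff)
      finally show ?thesis using t(2) by simp
    next
      case 2
      have "(\<Sum>u\<in>pverts ?G. if (v, u) \<in> parcs ?G then x u else 0) =
        (\<Sum>j<d. t * (t - real m + 1))
        + ((\<Sum>l<m. if k \<noteq> l then d * t else 0) + (\<Sum>p\<in>{..<c} \<times> {..<1::nat}. 0))"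
        unfolding split 2(2)
        by (intro arg_cong2[of _ _ _ _ "(+)"] sum.cong refl) (use 2(1) in \<open>auto simp: adj verts x_def\<close>)
      also have "\<dots> = d * (t * (t - m + 1)) + (real m - 1) * (d * t)"
        using 2(1) by (simp add: cnt)
      also have "\<dots> = t * x v" by (simp add: 2(2) x_def algebra_simps)
      finally show ?thesis .
    next
      case 3
      have "(\<Sum>u\<in>pverts ?G. if (v, u) \<in> parcs ?G then x u else 0) =
        (\<Sum>j<d. t * (t - real m + 1))
        + ((\<Sum>l<m. 0) + (\<Sum>p\<in>{..<c} \<times> {..<1::nat}. 0))"
        unfolding split 3(2)
        by (intro arg_cong2[of _ _ _ _ "(+)"] sum.cong refl) (use 3(1) in \<open>auto simp: adj verts x_def\<close>)
      also have "\<dots> = d * (t * (t - m + 1))"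
        using 3(1) by (simp add: cnt)
      also have "\<dots> = t * x v" by (simp add: 3(2) x_def algebra_simps)
      finally show ?thesis .
    qed
  qed
  then have "t \<le> graph_spectral_radius ?G" by (rule graph_spectral_radius_ge)
  then show ?thesis using t(1) m by simp
qed

subsection \<open>Strong parity factors\<close>

lemma out_degree_with_proj: "out_degree (with_proj G) v = card (parcs G `` {v})"
proof -
  have "out_arcs (with_proj G) v = Pair v ` (parcs G `` {v})" by (auto simp: out_arcs_def)
  then show ?thesis by (simp add: out_degree_def card_image inj_on_def)
qed

text \<open>A walk starting in \<open>C\<close> stays there if no arc leaves \<open>C\<close>; since
  arcs are symmetric, the symmetric closure in the definition of connectedness adds none.\<close>

lemma connected_cut_arc:
  assumes G: "pair_graph G" and con: "Digraph_Component.connected (with_proj G)"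
    and C: "C \<subseteq> pverts G" "C \<noteq> {}" "C \<noteq> pverts G"
  shows "\<exists>x\<in>C. \<exists>y\<in>pverts G - C. (x, y) \<in> parcs G"
proof (rule ccontr)
  assume closed: "\<not> ?thesis"
  let ?S = "with_proj (mk_symmetric (with_proj G))"
  have arcs: "arcs_ends ?S \<subseteq> parcs G"
    using pair_graphD(3)[OF G]
    by (auto simp: arcs_ends_def arc_to_ends_def mk_symmetric_def dest: symD)
  obtain u v where uv: "u \<in> C" "v \<in> pverts G" "v \<notin> C" using C by blast
  have "u \<rightarrow>\<^sup>*\<^bsub>?S\<^esub> v"
    using con uv C(1) by (auto simp: connected_def strongly_connected_def mk_symmetric_def)
  then have "(u, v) \<in> rtrancl_on (verts ?S) (arcs_ends ?S)" by (simp add: reachable_def)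
  then have "v \<in> C"
    using uv(1)
  proof (induction rule: rtrancl_on.induct)
    case (rtrancl_on_into_rtrancl_on w z)
    then show ?case using closed arcs pair_graphD(2)[OF G] by blast
  qed
  then show False using uv(3) by simp
qed

theorem theorem1p1:
  fixes G :: "'a pair_pre_digraph" and n \<delta> :: nat
  assumes "\<delta> \<ge> 3"
    and "pair_graph G"
    and "Digraph_Component.connected (with_proj G)"
    and "card (pverts G) = n"
    and "n \<ge> 2 * \<delta>\<^sup>2"
    and "min_degree G = \<delta>"
    and "graph_spectral_radius G \<ge> graph_spectral_radius (extremal_graph n \<delta>)"
  shows "has_strong_parity_factor G \<or>
    digraph_iso (with_proj G) (with_proj (extremal_graph n \<delta>))"
proof -
  let ?V = "pverts G" and ?E = "parcs G"
  note fin = pair_graphD(1)[OF assms(2)] and EV = pair_graphD(2)[OF assms(2)]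
    and sym = pair_graphD(3)[OF assms(2)]
  have irrefl: "irrefl ?E" using pair_graphD(4)[OF assms(2)] by (auto simp: irrefl_def)
  have ne: "?V \<noteq> {}" using assms(3) by (simp add: connected_def strongly_connected_def)
  have deg: "\<delta> \<le> card (?E `` {v})" if "v \<in> ?V" for v
    using assms(6) that fin by (auto simp: min_degree_def out_degree_with_proj)
  have bound: "card (components ?E (?V - T)) + 2 * card T \<le> (\<Sum>v\<in>T. card (?E `` {v})) + 1"
    if T: "T \<subseteq> ?V" for T
  proof (rule ccontr)
    assume "\<not> ?thesis"
    then have "card (?E `` {v}) + \<delta>\<^sup>2 \<le> card ?V" if "v \<in> ?V" for v
      using that assms(4,5)
      by (intro degree_bound_of_deficient_set[OF fin EV sym irrefl
            connected_cut_arc[OF assms(2,3)] deg assms(1) _ T]) auto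
    then have "card (?E `` {v}) \<le> n - \<delta>\<^sup>2" if "v \<in> ?V" for v using that assms(4) by fastforce
    then have "graph_spectral_radius G \<le> real (n - \<delta>\<^sup>2)"
      by (rule graph_spectral_radius_le_max_degree[OF assms(2) ne])
    \<comment> \<open>The gap is \<open>2 *\<close>\<delta>\<open>- 2\<close>, which is positive;
      the lower bound on \<open>n\<close> makes the natural subtraction exact.\<close>
    also have "\<dots> < real n - real \<delta> ^ 2 + 2 * real \<delta> - 2"
      using assms(1,5) by (simp add: of_nat_diff)
    also have "\<dots> \<le> graph_spectral_radius (extremal_graph n \<delta>)"
      by (rule graph_spectral_radius_extremal_graph[OF assms(1,5)])
    finally show False using assms(7) by simp
  qed
  have "has_strong_parity_factor G"
    unfolding has_strong_parity_factor_def
  proof (intro allI impI)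
    fix X assume X: "X \<subseteq> ?V" "even (card X)"
    have deg2: "2 \<le> card (?E `` {v})" if "v \<in> ?V" for v using deg[OF that] assms(1) by simp
    obtain F where F: "F \<subseteq> ?E" "sym F"
      "\<And>v. v \<in> ?V \<Longrightarrow> 1 \<le> card (F `` {v}) \<and> (odd (card (F `` {v})) \<longleftrightarrow> v \<in> X)"
      using strong_parity_subgraph[OF fin EV sym irrefl deg2 bound X] by blast
    define H where "H = \<lparr> pverts = ?V, parcs = F \<rparr>"
    have H: "pair_graph H"
      unfolding H_def using fin EV F pair_graphD(4)[OF assms(2)] by (intro pair_graphI) auto
    interpret G: pair_graph G by fact
    interpret H: pair_graph H by fact
    have "spanning (with_proj H) (with_proj G)"
      using F(1) G.wf_digraph H.wf_digraph
      by (auto simp: spanning_def subgraph_def compatible_def H_def)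
    moreover have "1 \<le> min_degree H"
      unfolding min_degree_def using fin ne F(3)
      by (subst Min_ge_iff) (auto simp: H_def out_degree_with_proj)
    ultimately show "\<exists>F. pair_graph F \<and> spanning (with_proj F) (with_proj G) \<and> 1 \<le> min_degree F \<and>
        (\<forall>u\<in>X. odd (out_degree (with_proj F) u)) \<and>
        (\<forall>v\<in>?V - X. even (out_degree (with_proj F) v))"
      using H F(3) X(1) by (intro exI[of _ H]) (auto simp: out_degree_with_proj H_def)
  qed
  then show ?thesis ..
qed

end
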